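(* Let $n\ge m\ge1$ and $1\le k\le n-1$. Let $f$ be a continuous function on $\mathfrak M_{n,m}$ satisfying $$f(x)=O(|I_m+x'x|^{-\lambda/2}).\qquad( * )$$ If $\lambda>k+m-1$, then the Radon transform $\hat f(\xi,t)$ is finite for all $(\xi,t)\in V_{n,n-k}\times\mathfrak M_{n-k,m}$. If $\lambda\le k+m-1$, then there is a function $f_\lambda$ which obeys $( * )$ and for which $\hat f_\lambda(\xi,t)\equiv\infty$.
   Context: $\mathfrak M_{n,m}$: real $n\times m$ matrices with Lebesgue measure; $x'$ transpose; $|a|$ absolute value of the determinant; $V_{n,n-k}=\{\xi\in\mathfrak M_{n,n-k}:\xi'\xi=I_{n-k}\}$; $\lambda$ is real. Radon transform: $\hat f(\xi,t)=\int_{\mathfrak M_{k,m}}f\left(g_\xi\begin{bmatrix}\omega\\ t\end{bmatrix}\right)d\omega$, where $g_\xi\in SO(n)$ is any rotation sending $\begin{bmatrix}0\\ I_{n-k}\end{bmatrix}$ to $\xi$. The function $f_\lambda$ is continuous and nonnegative, so $\hat f_\lambda(\xi,t)\equiv\infty$ means the integral equals $+\infty$ for every $(\xi,t)$. *)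

theory Defs
  imports "HOL-Analysis.Analysis" "HOL-Library.Landau_Symbols"
begin

text \<open>
  A real \<open>n \<times> m\<close> matrix is an element of \<open>real^'m^'n\<close>; the norm of this Euclidean space is the
  Frobenius norm, so \<open>lborel\<close> is Lebesgue measure in the matrix entries. The dimension \<open>n\<close> is
  split as \<open>k + (n - k)\<close> by indexing the rows with the sum type \<open>'k + 'l\<close>, where
  \<open>k = CARD('k)\<close> and \<open>n - k = CARD('l)\<close>.
\<close>

definition vstack :: "'a^'m^'k \<Rightarrow> 'a^'m^'l \<Rightarrow> 'a^'m^('k + 'l)" where
  "vstack \<omega> t = (\<chi> i. case i of Inl a \<Rightarrow> \<omega> $ a | Inr b \<Rightarrow> t $ b)"

definition stiefel :: "(real^'l^'n) set" where
  "stiefel = {\<xi>. transpose \<xi> ** \<xi> = mat 1}"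

definition is_frame_rotation :: "real^'l^('k::finite + 'l::finite) \<Rightarrow> real^('k + 'l)^('k + 'l) \<Rightarrow> bool" where
  "is_frame_rotation \<xi> g \<longleftrightarrow> rotation_matrix g \<and> g ** vstack 0 (mat 1) = \<xi>"

text \<open>
  The rotation used to parametrise the planes is unspecified; \<open>ex_frame_rotation\<close> below shows that
  there always is one, and \<open>radon_transform_finite_eq\<close>, \<open>radon_transform_eq\<close> and
  \<open>radon_transform_nonneg_eq\<close> show that nothing depends on the choice.
\<close>

definition frame_rotation :: "real^'l^('k::finite + 'l::finite) \<Rightarrow> real^('k + 'l)^('k + 'l)" where
  "frame_rotation \<xi> = (SOME g. is_frame_rotation \<xi> g)"

definition radon_integrand ::
  "(real^'m^('k::finite + 'l::finite) \<Rightarrow> 'b) \<Rightarrow> real^'l^('k + 'l) \<Rightarrow> real^'m^'l \<Rightarrow> real^'m^'k \<Rightarrow> 'b" where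
  "radon_integrand f \<xi> t \<omega> = f (frame_rotation \<xi> ** vstack \<omega> t)"

text \<open>
  The Radon transform of \<open>f\<close> at \<open>(\<xi>, t)\<close> is the Lebesgue integral of \<open>radon_integrand f \<xi> t\<close>. It is
  finite if that integral converges absolutely. The Bochner integral has the junk value 0 otherwise,
  so divergence for a nonnegative \<open>f\<close> is expressed with the \<open>[0, \<infinity>]\<close>-valued version.
\<close>

definition radon_transform ::
  "(real^'m^('k::finite + 'l::finite) \<Rightarrow> 'b::{banach, second_countable_topology})
    \<Rightarrow> real^'l^('k + 'l) \<Rightarrow> real^'m^'l \<Rightarrow> 'b" where
  "radon_transform f \<xi> t = (\<integral>\<omega>. radon_integrand f \<xi> t \<omega> \<partial>lborel)"

definition radon_transform_finite ::
  "(real^'m^('k::finite + 'l::finite) \<Rightarrow> 'b::{banach, second_countable_topology})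
    \<Rightarrow> real^'l^('k + 'l) \<Rightarrow> real^'m^'l \<Rightarrow> bool" where
  "radon_transform_finite f \<xi> t \<longleftrightarrow> integrable lborel (radon_integrand f \<xi> t)"

definition radon_transform_nonneg ::
  "(real^'m^('k::finite + 'l::finite) \<Rightarrow> real) \<Rightarrow> real^'l^('k + 'l) \<Rightarrow> real^'m^'l \<Rightarrow> ennreal" where
  "radon_transform_nonneg f \<xi> t = (\<integral>\<^sup>+\<omega>. ennreal (radon_integrand f \<xi> t \<omega>) \<partial>lborel)"

text \<open>
  For continuous \<open>f\<close> the bound at infinity is the same as a bound on the whole matrix space, because
  the comparison function is continuous and positive.
\<close>

definition matrix_decay :: "real \<Rightarrow> (real^'m^'n \<Rightarrow> 'b::real_normed_field) \<Rightarrow> bool" where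
  "matrix_decay lam f \<longleftrightarrow>
     f \<in> O[at_infinity](\<lambda>x. of_real (\<bar>det (mat 1 + transpose x ** x)\<bar> powr (- lam / 2)))"


subsection \<open>Existence of the rotation\<close>

lemma sum_UNIV_Plus:
  fixes h :: "('k::finite + 'l::finite) \<Rightarrow> 'a::comm_monoid_add"
  shows "sum h UNIV = (\<Sum>a\<in>UNIV. h (Inl a)) + (\<Sum>b\<in>UNIV. h (Inr b))"
  by (simp add: UNIV_Plus_UNIV [symmetric] sum.Plus del: UNIV_Plus_UNIV)

lemma stiefel_columns:
  assumes "\<xi> \<in> stiefel"
  shows "column i \<xi> \<bullet> column j \<xi> = (if i = j then 1 else 0)"
proof -
  have "(transpose \<xi> ** \<xi>) $ i $ j = (mat 1 :: real^'a^'a) $ i $ j"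
    using assms by (simp add: stiefel_def)
  then show ?thesis
    by (simp add: matrix_matrix_mult_def transpose_def column_def inner_vec_def mat_def)
qed

lemma matrix_mult_vstack_unit:
  fixes g :: "real^('k::finite + 'l::finite)^('k + 'l)"
  shows "g ** vstack 0 (mat 1) = (\<chi> i b. g $ i $ Inr b)"
  by (simp add: vec_eq_iff matrix_matrix_mult_def vstack_def sum_UNIV_Plus mat_def if_distrib
      cong: if_cong)

lemma ex_frame_rotation:
  fixes \<xi> :: "real^'l::finite^('k::finite + 'l)"
  assumes "\<xi> \<in> stiefel"
  shows "\<exists>g. is_frame_rotation \<xi> g"
proof -
  define B where "B = range (\<lambda>j. column j \<xi>)"
  note ip = stiefel_columns[OF assms]
  have inj: "inj (\<lambda>j. column j \<xi>)"
    by (rule injI) (metis ip zero_neq_one)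
  have "independent B"
  proof (rule pairwise_orthogonal_independent)
    show "pairwise orthogonal B"
      by (auto simp: B_def pairwise_def orthogonal_def ip)
    show "0 \<notin> B"
    proof
      assume "0 \<in> B"
      then obtain j where "column j \<xi> = 0"
        by (auto simp: B_def)
      then show False
        using ip[of j j] by simp
    qed
  qed
  then have dimB: "dim (span B) = CARD('l)"
    using inj by (simp add: dim_eq_card_independent B_def card_image)
  define W where "W = {y. \<forall>x\<in>span B. orthogonal x y}"
  have "dim W + dim (span B) = dim (UNIV :: (real^('k + 'l)) set)"
    using dim_subspace_orthogonal_to_vectors[of "span B" "UNIV :: (real^('k + 'l)) set"]
    by (simp add: W_def)
  then have dimW: "dim W = CARD('k)"
    using dimB by simp
  have subW: "subspace W"
    unfolding W_def by (simp add: subspace_orthogonal_to_vectors)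
  obtain T where T: "T \<subseteq> W" "pairwise orthogonal T" "\<And>x. x \<in> T \<Longrightarrow> norm x = 1"
      "independent T" "card T = dim W"
    using orthonormal_basis_subspace[OF subW] by metis
  have "finite T"
    using T(4) independent_imp_finite by blast
  then obtain h where h: "bij_betw h (UNIV :: 'k set) T"
    using T(5) dimW by (metis finite_same_card_bij finite)
  have hT: "h a \<in> T" for a
    using h by (auto simp: bij_betw_def)
  have ipT: "h a \<bullet> h b = (if a = b then 1 else 0)" for a b
  proof (cases "a = b")
    case True
    then show ?thesis
      using T(3)[OF hT[of a]] by (simp add: norm_eq_1)
  next
    case False
    then have "h a \<noteq> h b"
      using h by (auto simp: bij_betw_def inj_def)
    then show ?thesis
      using T(2) hT False by (auto simp: pairwise_def orthogonal_def)
  qed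
  have ipTB: "column j \<xi> \<bullet> h a = 0" for a j
  proof -
    have "column j \<xi> \<in> span B"
      by (simp add: B_def span_base)
    then show ?thesis
      using hT[of a] T(1) by (auto simp: W_def orthogonal_def)
  qed
  define G where "G = (\<lambda>s::real. \<lambda>a0. (\<chi> i j. case j of
      Inl a \<Rightarrow> (if a = a0 then s else 1) * h a $ i | Inr b \<Rightarrow> \<xi> $ i $ b)
      :: real^('k + 'l)^('k + 'l))"
  have colL: "column (Inl a) (G s a0) = (if a = a0 then s else 1) *\<^sub>R h a" for s a0 a
    by (simp add: G_def column_def vec_eq_iff)
  have colR: "column (Inr b) (G s a0) = column b \<xi>" for s a0 b
    by (simp add: G_def column_def vec_eq_iff)
  have orth: "orthogonal_matrix (G s a0)" if "s * s = 1" for s a0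
  proof -
    have "column i (G s a0) \<bullet> column j (G s a0) = (if i = j then 1 else 0)" for i j
      using that
      by (cases i; cases j) (auto simp: colL colR ip ipT ipTB inner_commute[of "h _" "column _ _"])
    then show ?thesis
      unfolding orthogonal_matrix
      by (simp add: vec_eq_iff matrix_matrix_mult_def transpose_def column_def inner_vec_def mat_def)
  qed
  have img: "G s a0 ** vstack 0 (mat 1) = \<xi>" for s a0
    by (simp add: matrix_mult_vstack_unit G_def vec_eq_iff)
  obtain a0 :: 'k where True by simp
  have det: "det (G (-1) a0) = - det (G 1 a0)"
  proof -
    let ?D = "(\<chi> i j. if i = j then (if i = Inl a0 then - 1 else 1) else 0)
      :: real^('k + 'l)^('k + 'l)"
    have "G (-1) a0 = G 1 a0 ** ?D"
      by (auto simp: vec_eq_iff matrix_matrix_mult_def G_def if_distrib[where f = "\<lambda>z. _ * z"] split: sum.split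
          cong: if_cong)
    moreover have "det ?D = - 1"
    proof -
      have "det ?D = (\<Prod>i\<in>(UNIV :: ('k + 'l) set). if i = Inl a0 then - 1 else 1)"
        by (subst det_diagonal) auto
      also have "\<dots> = - 1"
        using prod.delta[of UNIV "Inl a0 :: 'k + 'l" "\<lambda>_. - 1 :: real"] by simp
      finally show ?thesis .
    qed
    ultimately show ?thesis
      by (simp add: det_mul)
  qed
  have "det (G 1 a0) = 1 \<or> det (G 1 a0) = - 1"
    using det_orthogonal_matrix[OF orth[of 1 a0]] by simp
  then show ?thesis
  proof
    assume "det (G 1 a0) = 1"
    then show ?thesis
      using orth[of 1 a0] img[of 1 a0] by (auto simp: is_frame_rotation_def rotation_matrix_def)
  next
    assume "det (G 1 a0) = - 1"
    then show ?thesis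
      using orth[of "-1" a0] img[of "-1" a0] det
      by (auto simp: is_frame_rotation_def rotation_matrix_def)
  qed
qed

lemma frame_rotation:
  fixes \<xi> :: "real^'l::finite^('k::finite + 'l)"
  assumes "\<xi> \<in> stiefel"
  shows "is_frame_rotation \<xi> (frame_rotation \<xi>)"
  unfolding frame_rotation_def using ex_frame_rotation[OF assms] by (rule someI_ex)


subsection \<open>Independence of the rotation\<close>

lemma lborel_distr_orthogonal:
  fixes L :: "'a::euclidean_space \<Rightarrow> 'a"
  assumes L: "orthogonal_transformation L"
  shows "distr lborel borel L = lborel"
proof (rule measure_eqI)
  fix A :: "'a set" assume "A \<in> sets (distr lborel borel L)"
  then have A[measurable]: "A \<in> sets borel" by simp
  have lin: "linear L" and nrm: "\<And>x. norm (L x) = norm x"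
    using L by (auto simp: orthogonal_transformation)
  have Lm[measurable]: "L \<in> borel_measurable borel"
    using lin by (intro borel_measurable_continuous_onI linear_continuous_on)
      (simp add: linear_conv_bounded_linear)
  obtain Li where Li: "\<And>x. L (Li x) = x"
    using orthogonal_transformation_surj[OF L] by (metis surjD)
  define i :: "'a set \<Rightarrow> 'a \<Rightarrow> ennreal" where "i = indicator"
  define B :: "'a set" where "B = cball 0 1"
  have [measurable]: "i A \<in> borel_measurable borel" "i B \<in> borel_measurable borel"
    unfolding i_def B_def by (auto intro!: borel_measurable_indicator)
  have shift: "(\<integral>\<^sup>+x. h (x + c) \<partial>lborel) = (\<integral>\<^sup>+x. h x \<partial>lborel)"
    if [measurable]: "h \<in> borel_measurable borel" for h :: "'a \<Rightarrow> ennreal" and c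
  proof -
    have "(\<integral>\<^sup>+x. h x \<partial>lborel) = (\<integral>\<^sup>+x. h x \<partial>distr lborel borel ((+) c))"
      by (simp add: lborel_distr_plus)
    also have "\<dots> = (\<integral>\<^sup>+x. h (c + x) \<partial>lborel)"
      by (rule nn_integral_distr) auto
    finally show ?thesis by (simp add: add.commute)
  qed
  have reflect: "i B (- x) = i B x" and rot: "i B (L x) = i B x" for x
    by (auto simp: i_def B_def indicator_def nrm)
  have "emeasure (distr lborel borel L) A * emeasure lborel B
      = (\<integral>\<^sup>+x. i A (L x) \<partial>lborel) * emeasure lborel B"
    by (subst nn_integral_indicator[symmetric], simp, subst nn_integral_distr) (auto simp: i_def)
  also have "\<dots> = (\<integral>\<^sup>+x. i A (L x) * (\<integral>\<^sup>+y. i B y \<partial>lborel) \<partial>lborel)"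
    by (subst nn_integral_multc) (auto simp: i_def B_def)
  also have "\<dots> = (\<integral>\<^sup>+x. i A (L x) * (\<integral>\<^sup>+y. i B (y - L x) \<partial>lborel) \<partial>lborel)"
    using shift[of "i B" "- L x" for x] by simp
  also have "\<dots> = (\<integral>\<^sup>+x. (\<integral>\<^sup>+y. i A (L x) * i B (y - L x) \<partial>lborel) \<partial>lborel)"
    by (subst nn_integral_cmult) auto
  also have "\<dots> = (\<integral>\<^sup>+y. (\<integral>\<^sup>+x. i A (L x) * i B (y - L x) \<partial>lborel) \<partial>lborel)"
    by (rule lborel_pair.Fubini') measurable
  also have "\<dots> = (\<integral>\<^sup>+y. (\<integral>\<^sup>+x. i A (L x + y) * i B (L x) \<partial>lborel) \<partial>lborel)"
  proof (rule nn_integral_cong)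
    fix y :: 'a
    have "(\<integral>\<^sup>+x. i A (L x) * i B (y - L x) \<partial>lborel)
        = (\<integral>\<^sup>+x. i A (L (x + Li y)) * i B (y - L (x + Li y)) \<partial>lborel)"
      by (rule shift[symmetric]) measurable
    also have "\<dots> = (\<integral>\<^sup>+x. i A (L x + y) * i B (L x) \<partial>lborel)"
      using lin by (intro nn_integral_cong) (simp add: linear_add Li reflect)
    finally show "(\<integral>\<^sup>+x. i A (L x) * i B (y - L x) \<partial>lborel)
        = (\<integral>\<^sup>+x. i A (L x + y) * i B (L x) \<partial>lborel)" .
  qed
  also have "\<dots> = (\<integral>\<^sup>+x. (\<integral>\<^sup>+y. i A (L x + y) * i B (L x) \<partial>lborel) \<partial>lborel)"
    by (rule lborel_pair.Fubini') measurable
  also have "\<dots> = (\<integral>\<^sup>+x. (\<integral>\<^sup>+y. i A (y + L x) \<partial>lborel) * i B x \<partial>lborel)"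
    by (subst nn_integral_multc) (auto simp: rot add.commute)
  also have "\<dots> = (\<integral>\<^sup>+x. emeasure lborel A * i B x \<partial>lborel)"
    by (subst shift) (auto simp: i_def)
  also have "\<dots> = emeasure lborel A * emeasure lborel B"
    unfolding i_def B_def by (subst nn_integral_cmult) (auto intro!: borel_measurable_indicator)
  finally have eq: "emeasure (distr lborel borel L) A * emeasure lborel B
      = emeasure lborel A * emeasure lborel B" .
  have "emeasure lborel B \<noteq> \<infinity>"
    unfolding B_def by (metis bounded_cball emeasure_bounded_finite less_irrefl infinity_ennreal_def)
  moreover have "emeasure lborel B \<noteq> 0"
    unfolding B_def by (simp add: emeasure_cball unit_ball_vol_pos less_imp_neq[symmetric])
  ultimately show "emeasure (distr lborel borel L) A = emeasure lborel A"
    using eq by (metis ennreal_mult_cancel_left infinity_ennreal_def mult.commute)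
qed simp

lemma is_frame_rotation_unique:
  fixes \<xi> :: "real^'l::finite^('k::finite + 'l)"
  assumes g1: "is_frame_rotation \<xi> g1" and g2: "is_frame_rotation \<xi> g2"
  obtains L :: "real^'m::finite^'k \<Rightarrow> real^'m^'k" where "orthogonal_transformation L"
    and "\<And>\<omega> t. g1 ** vstack \<omega> t = g2 ** vstack (L \<omega>) t"
proof -
  define h where "h = transpose g2 ** g1"
  have o1: "orthogonal_matrix g1" and o2: "orthogonal_matrix g2"
    using g1 g2 by (auto simp: is_frame_rotation_def rotation_matrix_def)
  have oh: "orthogonal_matrix h"
    unfolding h_def using o1 o2
    by (simp add: orthogonal_matrix_mul orthogonal_matrix_transpose)
  have gh: "g1 = g2 ** h"
    using o2 by (simp add: h_def matrix_mul_assoc orthogonal_matrix_def)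
  have "h ** vstack 0 (mat 1) = (vstack 0 (mat 1) :: real^'l^('k + 'l))"
  proof -
    have "h ** vstack 0 (mat 1) = transpose g2 ** (g2 ** vstack 0 (mat 1))"
      using g1 g2 by (simp add: h_def is_frame_rotation_def matrix_mul_assoc[symmetric])
    then show ?thesis
      using o2 by (simp add: matrix_mul_assoc orthogonal_matrix_def)
  qed
  then have hR: "h $ i $ Inr b = (if i = Inr b then 1 else 0)" for i b
    unfolding matrix_mult_vstack_unit
    by (auto simp: vec_eq_iff vstack_def mat_def split: sum.splits)
  have hrow: "(\<Sum>j\<in>UNIV. h $ i $ j * h $ i' $ j) = (if i = i' then 1 else 0)" for i i'
  proof -
    have "(h ** transpose h) $ i $ i' = (mat 1 :: real^('k + 'l)^('k + 'l)) $ i $ i'"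
      using oh by (simp add: orthogonal_matrix_def)
    then show ?thesis
      by (simp add: matrix_matrix_mult_def transpose_def mat_def)
  qed
  have hcol: "(\<Sum>j\<in>UNIV. h $ j $ i * h $ j $ i') = (if i = i' then 1 else 0)" for i i'
  proof -
    have "(transpose h ** h) $ i $ i' = (mat 1 :: real^('k + 'l)^('k + 'l)) $ i $ i'"
      using oh by (simp add: orthogonal_matrix_def)
    then show ?thesis
      by (simp add: matrix_matrix_mult_def transpose_def mat_def)
  qed
  have hL: "h $ Inr b $ Inl a = 0" for a b
  proof -
    have "(\<Sum>a\<in>UNIV. h $ Inr b $ Inl a * h $ Inr b $ Inl a) = 0"
      using hrow[of "Inr b" "Inr b"]
      by (simp add: sum_UNIV_Plus hR if_distrib cong: if_cong)
    then have "h $ Inr b $ Inl a * h $ Inr b $ Inl a = 0"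
      by (subst (asm) sum_nonneg_eq_0_iff) auto
    then show ?thesis by simp
  qed
  define \<theta> where "\<theta> = ((\<chi> a c. h $ Inl a $ Inl c) :: real^'k^'k)"
  have "orthogonal_matrix \<theta>"
    unfolding orthogonal_matrix
  proof (simp add: vec_eq_iff, intro allI)
    fix c c'
    show "(transpose \<theta> ** \<theta>) $ c $ c' = (mat 1 :: real^'k^'k) $ c $ c'"
      using hcol[of "Inl c" "Inl c'"]
      by (simp add: sum_UNIV_Plus hL \<theta>_def matrix_matrix_mult_def transpose_def mat_def)
  qed
  then have \<theta>: "transpose \<theta> ** \<theta> = mat 1"
    by (simp add: orthogonal_matrix)
  define L where "L = (\<lambda>\<omega> :: real^'m^'k. \<theta> ** \<omega>)"
  have "orthogonal_transformation L"
    unfolding orthogonal_transformation_def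
  proof
    show "linear L"
      unfolding L_def
      by (rule linearI) (simp_all add: vec_eq_iff matrix_matrix_mult_def sum.distrib algebra_simps
          sum_distrib_left)
    have cols: "x \<bullet> y = (\<Sum>j\<in>UNIV. column j x \<bullet> column j y)" for x y :: "real^'m^'k"
      unfolding inner_vec_def column_def by (simp add: inner_vec_def) (rule sum.swap)
    have "column j (L x) = \<theta> *v column j x" for j and x :: "real^'m^'k"
      by (simp add: L_def vec_eq_iff column_def matrix_matrix_mult_def matrix_vector_mult_def)
    moreover have "(\<theta> *v u) \<bullet> (\<theta> *v v) = u \<bullet> v" for u v
    proof -
      have "orthogonal_transformation ((*v) \<theta>)"
        using \<open>orthogonal_matrix \<theta>\<close> by (simp add: orthogonal_transformation_matrix)
      then show ?thesis
        by (simp add: orthogonal_transformation_def)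
    qed
    ultimately show "\<forall>v w. L v \<bullet> L w = v \<bullet> w"
      by (simp add: cols)
  qed
  moreover have "g1 ** vstack \<omega> t = g2 ** vstack (L \<omega>) t" for \<omega> :: "real^'m^'k" and t
  proof -
    have "h ** vstack \<omega> t = vstack (L \<omega>) t"
      by (auto simp: vec_eq_iff matrix_matrix_mult_def vstack_def sum_UNIV_Plus hR hL L_def \<theta>_def
          if_distrib[where f = "\<lambda>z. z * _"] split: sum.split cong: if_cong)
    then show ?thesis
      by (simp add: gh matrix_mul_assoc[symmetric])
  qed
  ultimately show thesis
    by (rule that)
qed

lemma measurable_vstack:
  fixes f :: "real^'m::finite^('k::finite + 'l::finite) \<Rightarrow> 'b::topological_space"
    and g :: "real^('k + 'l)^('k + 'l)"
  assumes "f \<in> borel_measurable borel"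
  shows "(\<lambda>\<omega>. f (g ** vstack \<omega> t)) \<in> borel_measurable borel"
proof -
  have "continuous_on UNIV (\<lambda>\<omega> :: real^'m^'k. g ** vstack \<omega> t)"
    unfolding matrix_matrix_mult_def vstack_def
    by (auto simp: sum_UNIV_Plus intro!: continuous_intros)
  then have "(\<lambda>\<omega>. g ** vstack \<omega> t) \<in> borel_measurable borel"
    by (rule borel_measurable_continuous_onI)
  then show ?thesis
    using assms by (rule measurable_compose)
qed

context
  fixes \<xi> :: "real^'l::finite^('k::finite + 'l)" and g
  assumes \<xi>: "\<xi> \<in> stiefel" and g: "is_frame_rotation \<xi> g"
begin

lemma radon_integrand_change_rotation:
  obtains L :: "real^'m::finite^'k \<Rightarrow> real^'m^'k" where "L \<in> borel_measurable borel"
    and "distr lborel borel L = lborel"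
    and "\<And>(f :: real^'m^('k + 'l) \<Rightarrow> 'b) t. radon_integrand f \<xi> t = (\<lambda>\<omega>. f (g ** vstack (L \<omega>) t))"
proof -
  obtain L :: "real^'m^'k \<Rightarrow> real^'m^'k" where L: "orthogonal_transformation L"
    and eq: "\<And>\<omega> t. frame_rotation \<xi> ** vstack \<omega> t = g ** vstack (L \<omega>) t"
    using is_frame_rotation_unique[OF frame_rotation[OF \<xi>] g] by blast
  have "L \<in> borel_measurable borel"
    using L by (intro borel_measurable_continuous_onI linear_continuous_on)
      (simp add: linear_conv_bounded_linear[symmetric] orthogonal_transformation_linear)
  then show thesis
    using that lborel_distr_orthogonal[OF L] eq by (metis (no_types, lifting) ext radon_integrand_def)
qed

lemma radon_transform_finite_eq:
  fixes f :: "real^'m::finite^('k + 'l) \<Rightarrow> 'b::{banach, second_countable_topology}"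
  assumes f: "f \<in> borel_measurable borel"
  shows "radon_transform_finite f \<xi> t \<longleftrightarrow> integrable lborel (\<lambda>\<omega>. f (g ** vstack \<omega> t))"
proof -
  obtain L :: "real^'m^'k \<Rightarrow> real^'m^'k" where L: "L \<in> borel_measurable borel"
    "distr lborel borel L = lborel" "radon_integrand f \<xi> t = (\<lambda>\<omega>. f (g ** vstack (L \<omega>) t))"
    using radon_integrand_change_rotation by metis
  then show ?thesis
    using integrable_distr_eq[of L lborel borel "\<lambda>\<omega>. f (g ** vstack \<omega> t)"] measurable_vstack[OF f]
    by (simp add: radon_transform_finite_def)
qed

lemma radon_transform_eq:
  fixes f :: "real^'m::finite^('k + 'l) \<Rightarrow> 'b::{banach, second_countable_topology}"
  assumes f: "f \<in> borel_measurable borel"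
  shows "radon_transform f \<xi> t = (\<integral>\<omega>. f (g ** vstack \<omega> t) \<partial>lborel)"
proof -
  obtain L :: "real^'m^'k \<Rightarrow> real^'m^'k" where L: "L \<in> borel_measurable borel"
    "distr lborel borel L = lborel" "radon_integrand f \<xi> t = (\<lambda>\<omega>. f (g ** vstack (L \<omega>) t))"
    using radon_integrand_change_rotation by metis
  then show ?thesis
    using integral_distr[of L lborel borel "\<lambda>\<omega>. f (g ** vstack \<omega> t)"] measurable_vstack[OF f]
    by (simp add: radon_transform_def)
qed

lemma radon_transform_nonneg_eq:
  fixes f :: "real^'m::finite^('k + 'l) \<Rightarrow> real"
  assumes f: "f \<in> borel_measurable borel"
  shows "radon_transform_nonneg f \<xi> t = (\<integral>\<^sup>+\<omega>. ennreal (f (g ** vstack \<omega> t)) \<partial>lborel)"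
proof -
  obtain L :: "real^'m^'k \<Rightarrow> real^'m^'k" where L: "L \<in> borel_measurable borel"
    "distr lborel borel L = lborel" "radon_integrand f \<xi> t = (\<lambda>\<omega>. f (g ** vstack (L \<omega>) t))"
    using radon_integrand_change_rotation by metis
  then show ?thesis
    using nn_integral_distr[of L lborel borel "\<lambda>\<omega>. ennreal (f (g ** vstack \<omega> t))"]
      measurable_vstack[OF f]
    by (simp add: radon_transform_nonneg_def)
qed

end

end

theory Submission
  imports Defs
begin

text \<open>
  With \<open>x = g\<^sub>\<xi> [\<omega>; t]\<close> one has \<open>x'x = t't + \<omega>'\<omega>\<close>, and \<open>\<omega>'\<omega>\<close> is the sum of the rank-one matrices
  \<open>vv'\<close> over the \<open>k\<close> rows \<open>v\<close> of \<open>\<omega>\<close>, so the integral of \<open>|I + x'x|\<close> to the power \<open>-s/2\<close> can be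
  evaluated one row at a time. If \<open>A\<close> is positive definite and \<open>B'AB = I\<close>, then
  \<open>|A + vv'| = |A| (1 + |B'v|\<^sup>2)\<close>, and the substitution \<open>u = B'v\<close> shows that integrating the power
  \<open>-s/2\<close> of \<open>|A + vv'|\<close> over \<open>v\<close> gives \<open>c(s)\<close> times the power \<open>-(s - 1)/2\<close> of \<open>|A|\<close>, where \<open>c(s)\<close>
  is the integral of the power \<open>-s/2\<close> of \<open>1 + |u|\<^sup>2\<close> over \<open>m\<close>-space. The \<open>k\<close> rows together contribute
  \<open>c(s) c(s - 1) \<dots> c(s - k + 1)\<close> times a positive number, which is finite for \<open>s - k + 1 > m\<close> and
  infinite for \<open>s - k + 1 = m\<close>. The critical function also serves all smaller exponents, because
  \<open>|I + x'x| \<ge> 1\<close>.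
\<close>

section \<open>Lebesgue measure on matrices and linear substitutions\<close>

lemma measurable_vec_lambda_PiM:
  "(\<lambda>f. \<chi> i. f i) \<in> borel_measurable (Pi\<^sub>M UNIV (\<lambda>_::'k::finite. lborel :: 'a::euclidean_space measure))"
proof (subst borel_measurable_euclidean_space, intro ballI)
  fix b :: "'a^'k" assume "b \<in> Basis"
  have *: "(\<lambda>f. f i \<bullet> b $ i) \<in> borel_measurable (Pi\<^sub>M UNIV (\<lambda>_. lborel))" for i
    by measurable
  show "(\<lambda>f. (\<chi> i. f i) \<bullet> b) \<in> borel_measurable (Pi\<^sub>M UNIV (\<lambda>_. lborel))"
    unfolding inner_vec_def by (simp add: *)
qed

lemma mem_box_vec: "x \<in> box l u \<longleftrightarrow> (\<forall>i. x $ i \<in> box (l $ i) (u $ i))"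
  for x :: "'a::euclidean_space^'k::finite"
  by (fastforce simp: mem_box Basis_vec_def inner_axis)

text \<open>The standard basis is a disjoint union of one copy of \<open>Basis\<close> per index,
  and \<open>axis i\<close> embeds each copy injectively.\<close>

lemma prod_Basis_vec:
  "(\<Prod>b\<in>(Basis :: ('a::euclidean_space^'k::finite) set). h b)
    = (\<Prod>i\<in>UNIV. \<Prod>c\<in>Basis. h (axis i c))"
proof -
  have "(\<Prod>b\<in>(Basis :: ('a^'k) set). h b)
      = (\<Prod>i\<in>(UNIV::'k set). \<Prod>b\<in>(\<lambda>c. axis i c) ` Basis. h b)"
    unfolding Basis_vec_def
    by (subst prod.UNION_disjoint [symmetric]) (auto simp: axis_eq_axis UNION_singleton_eq_range dest: nonzero_Basis)
  also have "\<dots> = (\<Prod>i\<in>UNIV. \<Prod>c\<in>Basis. h (axis i c))"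
    by (intro prod.cong refl prod.reindex_cong[OF _ refl]) (auto simp: inj_on_def axis_eq_axis)
  finally show ?thesis .
qed

text \<open>Lebesgue measure is determined by the volumes of boxes, and a box of vectors is a
  product of boxes, one per component. With vectors as components this splits a matrix integral into
  its rows; with real components it isolates a single coordinate.\<close>

lemma lborel_vec_eq_distr_PiM:
  "(lborel :: ('a::euclidean_space^'k::finite) measure)
    = distr (Pi\<^sub>M UNIV (\<lambda>_. lborel)) borel (\<lambda>f. \<chi> i. f i)"
proof (rule lborel_eqI)
  interpret product_sigma_finite "\<lambda>_::'k. lborel :: 'a measure" ..
  fix l u :: "'a^'k"
  assume le: "\<And>b. b \<in> Basis \<Longrightarrow> l \<bullet> b \<le> u \<bullet> b"
  have le': "l $ i \<bullet> c \<le> u $ i \<bullet> c" if "c \<in> Basis" for i c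
    using le[of "axis i c"] that by (simp add: inner_axis)
  have pre: "(\<lambda>f. \<chi> i. f i) -` box l u \<inter> space (Pi\<^sub>M UNIV (\<lambda>_. lborel))
      = (\<Pi>\<^sub>E i\<in>UNIV. box (l $ i) (u $ i))"
    by (auto simp: mem_box_vec space_PiM PiE_iff)
  have "emeasure (distr (Pi\<^sub>M UNIV (\<lambda>_. lborel)) borel (\<lambda>f. \<chi> i. f i)) (box l u)
      = (\<Prod>i\<in>UNIV. emeasure lborel (box (l $ i) (u $ i)))"
    by (simp add: emeasure_distr measurable_vec_lambda_PiM pre emeasure_PiM)
  also have "\<dots> = (\<Prod>i\<in>UNIV. ennreal (\<Prod>c\<in>Basis. (u $ i - l $ i) \<bullet> c))"
    using le' by (simp add: emeasure_lborel_box)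
  also have "\<dots> = ennreal (\<Prod>i\<in>UNIV. \<Prod>c\<in>Basis. (u $ i - l $ i) \<bullet> c)"
    using le' by (intro prod_ennreal prod_nonneg) (simp add: inner_diff_left)
  also have "\<dots> = ennreal (\<Prod>b\<in>Basis. (u - l) \<bullet> b)"
    by (simp add: prod_Basis_vec inner_axis)
  finally show "emeasure (distr (Pi\<^sub>M UNIV (\<lambda>_. lborel)) borel (\<lambda>f. \<chi> i. f i)) (box l u)
      = ennreal (\<Prod>b\<in>Basis. (u - l) \<bullet> b)" .
qed simp

lemma nn_integral_lborel_vec:
  fixes h :: "'a::euclidean_space^'k::finite \<Rightarrow> ennreal"
  assumes "h \<in> borel_measurable borel"
  shows "(\<integral>\<^sup>+x. h x \<partial>lborel) = (\<integral>\<^sup>+f. h (\<chi> i. f i) \<partial>Pi\<^sub>M UNIV (\<lambda>_. lborel))"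
proof -
  have "h \<in> borel_measurable (distr (Pi\<^sub>M UNIV (\<lambda>_. lborel)) borel (\<lambda>f. \<chi> i. f i))"
    using assms by simp
  from nn_integral_distr[OF measurable_vec_lambda_PiM this] show ?thesis
    by (subst lborel_vec_eq_distr_PiM)
qed

lemma nn_integral_lborel_translate:
  fixes h :: "'a::euclidean_space \<Rightarrow> ennreal"
  assumes [measurable]: "h \<in> borel_measurable borel"
  shows "(\<integral>\<^sup>+x. h (x + c) \<partial>lborel) = (\<integral>\<^sup>+x. h x \<partial>lborel)"
proof -
  have "(\<integral>\<^sup>+x. h x \<partial>lborel) = (\<integral>\<^sup>+x. h x \<partial>distr lborel borel ((+) c))"
    by (simp add: lborel_distr_plus)
  then show ?thesis
    by (simp add: nn_integral_distr add.commute)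
qed

text \<open>The change of variables in the library is restricted to well-ordered index types.\<close>

lemma nn_integral_lborel_linear:
  fixes f :: "real^'n::finite \<Rightarrow> real^'n"
  assumes "linear f" and "det (matrix f) \<noteq> 0" and "h \<in> borel_measurable borel"
  shows "ennreal \<bar>det (matrix f)\<bar> * (\<integral>\<^sup>+x. h (f x) \<partial>lborel) = (\<integral>\<^sup>+x. h x \<partial>lborel)"
proof -
  \<comment> \<open>The formula is guarded by a nonzero determinant, which makes the case of a
    vanishing coordinate vacuous. It quantifies over all \<open>h\<close> because a composition
    needs it for a modified integrand.\<close>
  define P where "P f \<longleftrightarrow> linear f \<and> (det (matrix f) \<noteq> 0 \<longrightarrow> (\<forall>h \<in> borel_measurable borel.
      ennreal \<bar>det (matrix f)\<bar> * (\<integral>\<^sup>+x. h (f x) \<partial>lborel) = (\<integral>\<^sup>+x. h x \<partial>lborel)))"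
    for f :: "real^'n \<Rightarrow> real^'n"
  have meas: "f \<in> borel_measurable borel" if "linear f" for f :: "real^'n \<Rightarrow> real^'n"
    using that by (intro borel_measurable_continuous_onI linear_continuous_on)
      (simp add: linear_conv_bounded_linear)
  have "P f"
  proof (rule induct_linear_elementary[where P = P, OF \<open>linear f\<close>], goal_cases)
    case (1 f g)
    show ?case
      unfolding P_def
    proof (intro conjI impI ballI)
      show "linear (f \<circ> g)"
        using 1 by (simp add: linear_compose)
      have det: "det (matrix (f \<circ> g)) = det (matrix f) * det (matrix g)"
        using 1 by (simp add: matrix_compose det_mul)
      fix h :: "real^'n \<Rightarrow> ennreal"
      assume "det (matrix (f \<circ> g)) \<noteq> 0" and h: "h \<in> borel_measurable borel"
      then have nz: "det (matrix f) \<noteq> 0" "det (matrix g) \<noteq> 0"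
        by (auto simp: det)
      have hf: "(\<lambda>x. h (f x)) \<in> borel_measurable borel"
        using meas[OF 1(1)] h by (rule measurable_compose)
      have "ennreal \<bar>det (matrix (f \<circ> g))\<bar> * (\<integral>\<^sup>+x. h ((f \<circ> g) x) \<partial>lborel)
          = ennreal \<bar>det (matrix f)\<bar> * (ennreal \<bar>det (matrix g)\<bar> * (\<integral>\<^sup>+x. h (f (g x)) \<partial>lborel))"
        by (simp add: det abs_mult ennreal_mult mult.assoc)
      \<comment> \<open>The formula for \<open>g\<close> is applied to
        \<open>\<lambda>x. h (f x)\<close>, then the one for \<open>f\<close> to
        \<open>h\<close>.\<close>
      also have "\<dots> = (\<integral>\<^sup>+x. h x \<partial>lborel)"
        using 1(3,4) nz h bspec[OF _ hf, of "\<lambda>h. _ * (\<integral>\<^sup>+x. h (g x) \<partial>lborel) = (\<integral>\<^sup>+x. h x \<partial>lborel)"]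
        unfolding P_def by simp
      finally show "ennreal \<bar>det (matrix (f \<circ> g))\<bar> * (\<integral>\<^sup>+x. h ((f \<circ> g) x) \<partial>lborel)
          = (\<integral>\<^sup>+x. h x \<partial>lborel)" .
    qed
  next
    case (2 f i)
    have "row i (matrix f) = 0"
      using 2(2) by (simp add: row_def matrix_def vec_eq_iff)
    then show ?case
      using det_zero_row(1) 2(1) by (auto simp: P_def)
  next
    case (3 c)
    let ?f = "\<lambda>x::real^'n. \<chi> i. c i * x $ i"
    have lin: "linear ?f"
      by (rule linearI) (auto simp: vec_eq_iff algebra_simps)
    have "matrix ?f $ i $ j = (if i = j then c i else 0)" for i j
      by (simp add: matrix_def axis_def)
    then have det: "det (matrix ?f) = prod c UNIV"
      by (subst det_diagonal) auto
    show ?case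
      unfolding P_def
    proof (intro conjI impI ballI lin)
      fix h :: "real^'n \<Rightarrow> ennreal"
      assume "det (matrix ?f) \<noteq> 0" and h: "h \<in> borel_measurable borel"
      then have nz: "c i \<noteq> 0" for i
        by (simp add: det)
      \<comment> \<open>\<open>lborel_affine_euclidean\<close> takes its scaling factors per basis
        vector, so \<open>c\<close> is re-indexed from coordinates to \<open>Basis\<close>.\<close>
      define d where "d b = c (axis_index b)" for b :: "real^'n"
      have b: "(\<Sum>j\<in>Basis. (d j * (x \<bullet> j)) *\<^sub>R j) = ?f x" for x
      proof -
        have "(\<Sum>j\<in>Basis. (d j * (x \<bullet> j)) *\<^sub>R j) = (\<Sum>j\<in>Basis. (?f x \<bullet> j) *\<^sub>R j)"
          by (rule sum.cong) (auto simp: d_def Basis_vec_def inner_axis axis_index_axis)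
        then show ?thesis by (simp add: euclidean_representation)
      qed
      have lb: "lborel = density (distr lborel borel ?f) (\<lambda>_. ennreal (\<Prod>j\<in>Basis. \<bar>d j\<bar>))"
        using lborel_affine_euclidean[of d 0] nz by (simp add: d_def[symmetric] b) (simp add: d_def)
      have dd: "(\<Prod>j\<in>Basis. \<bar>d j\<bar>) = \<bar>det (matrix ?f)\<bar>"
        unfolding prod_Basis_vec det by (simp add: d_def axis_index_axis abs_prod)
      show "ennreal \<bar>det (matrix ?f)\<bar> * (\<integral>\<^sup>+x. h (?f x) \<partial>lborel) = (\<integral>\<^sup>+x. h x \<partial>lborel)"
        using h meas[OF lin]
        by (subst (2) lb) (simp add: nn_integral_density nn_integral_cmult nn_integral_distr dd)
    qed
  next
    case (4 m n)
    let ?f = "\<lambda>x::real^'n. \<chi> i. x $ Transposition.transpose m n i"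
    \<comment> \<open>Swapping two coordinates is an isometry, so it preserves Lebesgue measure and
      its determinant is 1 or -1.\<close>
    have "orthogonal_transformation ?f"
      unfolding orthogonal_transformation_def
    proof (intro conjI allI)
      show "linear ?f"
        by (rule linearI) (auto simp: vec_eq_iff)
      show "?f v \<bullet> ?f w = v \<bullet> w" for v w
        unfolding inner_vec_def
        by (simp, rule sum.reindex_bij_betw[of "Transposition.transpose m n" UNIV UNIV "\<lambda>i. v $ i * w $ i"]) simp
    qed
    then have ot: "orthogonal_transformation ?f" .
    then have lin: "linear ?f"
      by (rule orthogonal_transformation_linear)
    have "orthogonal_matrix (matrix ?f)"
      using ot orthogonal_transformation_matrix by blast
    from det_orthogonal_matrix[OF this] have det: "\<bar>det (matrix ?f)\<bar> = 1"
      by auto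
    show ?case
      unfolding P_def det
    proof (intro conjI impI ballI lin)
      fix h :: "real^'n \<Rightarrow> ennreal"
      assume h: "h \<in> borel_measurable borel"
      then have "h \<in> borel_measurable (distr lborel borel ?f)"
        by simp
      moreover have "?f \<in> lborel \<rightarrow>\<^sub>M borel"
        using meas[OF lin] by simp
      ultimately have "(\<integral>\<^sup>+x. h x \<partial>distr lborel borel ?f) = (\<integral>\<^sup>+x. h (?f x) \<partial>lborel)"
        by (intro nn_integral_distr)
      then show "ennreal 1 * (\<integral>\<^sup>+x. h (?f x) \<partial>lborel) = (\<integral>\<^sup>+x. h x \<partial>lborel)"
        by (simp add: lborel_distr_orthogonal[OF ot])
    qed
  next
    case (5 m n)
    let ?f = "\<lambda>x::real^'n. \<chi> i. if i = m then x $ m + x $ n else x $ i"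
    have lin: "linear ?f"
      by (rule linearI) (auto simp: vec_eq_iff algebra_simps)
    have "matrix ?f = (\<chi> k. if k = m then row m (mat 1) + 1 *s row n (mat 1) else row k (mat 1))"
      by (auto simp: vec_eq_iff matrix_def row_def mat_def axis_def)
    with det_row_operation[OF 5(1), of "mat 1 :: real^'n^'n" 1] have det: "det (matrix ?f) = 1"
      by simp
    interpret product_sigma_finite "\<lambda>_::'n. lborel :: real measure" ..
    \<comment> \<open>With coordinate \<open>m\<close> as the inner variable and all others fixed,
      the shear is a translation by \<open>x n\<close>, which does not move because \<open>n\<close>
      differs from \<open>m\<close>. Translation invariance of the inner integral then
      suffices.\<close>
    have U: "UNIV = insert m (UNIV - {m})" by auto
    have "(\<integral>\<^sup>+x. h (?f x) \<partial>lborel) = (\<integral>\<^sup>+x. h x \<partial>lborel)"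
      if h: "h \<in> borel_measurable borel" for h
    proof -
      have hv: "(\<lambda>x. h (\<chi> i. x i)) \<in> borel_measurable (Pi\<^sub>M UNIV (\<lambda>_. lborel))"
        by (rule measurable_compose[OF measurable_vec_lambda_PiM h])
      have hf: "(\<lambda>x. h (?f x)) \<in> borel_measurable borel"
        by (rule measurable_compose[OF meas[OF lin] h])
      have hfv: "(\<lambda>x. h (?f (\<chi> i. x i))) \<in> borel_measurable (Pi\<^sub>M UNIV (\<lambda>_. lborel))"
        by (rule measurable_compose[OF measurable_vec_lambda_PiM hf])
      have "(\<integral>\<^sup>+x. h (?f x) \<partial>lborel) = (\<integral>\<^sup>+x. \<integral>\<^sup>+y. h (?f (\<chi> i. (x(m := y)) i)) \<partial>lborel
          \<partial>Pi\<^sub>M (UNIV - {m}) (\<lambda>_. lborel))"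
        unfolding nn_integral_lborel_vec[OF hf]
        by (subst U, subst product_nn_integral_insert) (use hfv U in auto)
      also have "\<dots> = (\<integral>\<^sup>+x. \<integral>\<^sup>+y. h (\<chi> i. (x(m := y)) i) \<partial>lborel
          \<partial>Pi\<^sub>M (UNIV - {m}) (\<lambda>_. lborel))"
      proof (rule nn_integral_cong)
        fix x :: "'n \<Rightarrow> real"
        have "continuous_on UNIV (\<lambda>y. (\<chi> i. (x(m := y)) i) :: real^'n)"
        proof (intro continuous_on_vec_lambda)
          show "continuous_on UNIV (\<lambda>y. (x(m := y)) i)" for i
            by (cases "i = m") auto
        qed
        then have "(\<lambda>y. (\<chi> i. (x(m := y)) i) :: real^'n) \<in> borel_measurable borel"
          by (rule borel_measurable_continuous_onI)
        from measurable_compose[OF this h]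
        have "(\<lambda>y. h (\<chi> i. (x(m := y)) i)) \<in> borel_measurable borel" .
        then have *: "(\<integral>\<^sup>+y. h (\<chi> i. (x(m := y + x n)) i) \<partial>lborel)
            = (\<integral>\<^sup>+y. h (\<chi> i. (x(m := y)) i) \<partial>lborel)"
          by (rule nn_integral_lborel_translate[of "\<lambda>y. h (\<chi> i. (x(m := y)) i)" "x n"])
        have **: "?f (\<chi> i. (x(m := y)) i) = (\<chi> i. (x(m := y + x n)) i)" for y
          using 5(1) by (auto simp: vec_eq_iff)
        show "(\<integral>\<^sup>+y. h (?f (\<chi> i. (x(m := y)) i)) \<partial>lborel)
            = (\<integral>\<^sup>+y. h (\<chi> i. (x(m := y)) i) \<partial>lborel)"
          unfolding ** by (rule *)
      qed
      also have "\<dots> = (\<integral>\<^sup>+x. h x \<partial>lborel)"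
        unfolding nn_integral_lborel_vec[OF h]
        using product_nn_integral_insert[of "UNIV - {m}" m "\<lambda>x. h (\<chi> i. x i)"] hv U by simp
      finally show ?thesis .
    qed
    then show ?case
      using lin by (simp add: P_def det)
  qed
  then show ?thesis
    using assms by (auto simp: P_def)
qed

section \<open>Positive definite matrices and rank-one updates\<close>

definition pos_def :: "real^'n::finite^'n \<Rightarrow> bool" where
  "pos_def A \<longleftrightarrow> transpose A = A \<and> (\<forall>x. x \<noteq> 0 \<longrightarrow> 0 < x \<bullet> (A *v x))"

definition outer :: "real^'n \<Rightarrow> real^'n^'n" where
  "outer v = (\<chi> i j. v $ i * v $ j)"

lemma transpose_outer [simp]: "transpose (outer v) = outer v"
  by (simp add: outer_def transpose_def vec_eq_iff mult.commute)

lemma outer_mult_vector: "outer v *v x = (v \<bullet> x) *\<^sub>R v"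
  by (simp add: outer_def matrix_vector_mult_def vec_eq_iff inner_vec_def sum_distrib_left
      sum_distrib_right ac_simps)

lemma outer_matrix_vector: "outer (M *v v) = M ** outer v ** transpose M"
  by (simp add: outer_def matrix_vector_mult_def matrix_matrix_mult_def transpose_def vec_eq_iff
      sum_product sum_distrib_left sum_distrib_right ac_simps)

lemma matrix_add_rdistrib: "(A + B) ** C = A ** C + B ** C"
  by (simp add: matrix_matrix_mult_def vec_eq_iff distrib_right sum.distrib)

lemma transpose_add: "transpose (A + B) = transpose A + transpose B"
  by (simp add: transpose_def vec_eq_iff)

lemma pos_def_plus_outer:
  assumes "pos_def A"
  shows "pos_def (A + outer v)"
proof -
  have "0 < x \<bullet> ((A + outer v) *v x)" if "x \<noteq> 0" for x
  proof -
    have "x \<bullet> ((A + outer v) *v x) = x \<bullet> (A *v x) + (v \<bullet> x)\<^sup>2"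
      by (simp add: matrix_vector_mult_add_rdistrib outer_mult_vector inner_add_right
          power2_eq_square inner_commute)
    then show ?thesis
      using assms that by (simp add: pos_def_def add_pos_nonneg)
  qed
  then show ?thesis
    using assms by (simp add: pos_def_def transpose_add)
qed

lemma pos_def_plus_sum_outer:
  assumes "pos_def A" and "finite I"
  shows "pos_def (A + (\<Sum>i\<in>I. outer (v i)))"
  using assms(2)
proof induction
  case (insert i I)
  then show ?case
    using pos_def_plus_outer[of "A + (\<Sum>i\<in>I. outer (v i))" "v i"] by (simp add: ac_simps)
qed (simp add: assms)

lemma pos_def_mat1: "pos_def (mat 1)"
  by (simp add: pos_def_def)

lemma transpose_mult_self: "transpose x ** x = (\<Sum>i\<in>UNIV. outer (x $ i))" for x :: "real^'m^'k::finite"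
  by (simp add: vec_eq_iff matrix_matrix_mult_def transpose_def outer_def)

lemma pos_def_mat1_plus_gram: "pos_def (mat 1 + transpose x ** x)" for x :: "real^'m::finite^'k::finite"
  by (simp add: transpose_mult_self pos_def_plus_sum_outer pos_def_mat1)

text \<open>Gram-Schmidt for the inner product defined by \<open>A\<close>.\<close>

lemma pos_def_congruent_mat1:
  fixes A :: "real^'n::finite^'n"
  assumes A: "pos_def A"
  obtains B :: "real^'n^'n" where "transpose B ** A ** B = mat 1"
proof -
  have sym: "x \<bullet> (A *v y) = y \<bullet> (A *v x)" for x y
    using A by (metis dot_lmul_matrix inner_commute pos_def_def transpose_matrix_vector)
  have "\<exists>b. \<forall>i\<in>S. \<forall>j\<in>S. b i \<bullet> (A *v b j) = (if i = j then 1 else 0)" for S :: "'n set"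
  proof (induction S rule: finite_induct[OF finite])
    case (2 i S)
    then obtain b where "\<forall>i\<in>S. \<forall>j\<in>S. b i \<bullet> (A *v b j) = (if i = j then 1 else 0)"
      by blast
    then have b: "b i \<bullet> (A *v b j) = (if i = j then 1 else 0)" if "i \<in> S" "j \<in> S" for i j
      using that by blast
    \<comment> \<open>Since \<open>S\<close> misses \<open>i\<close>, the vectors
      \<open>A *v b j\<close> span a proper subspace. A nonzero \<open>x\<close> orthogonal to it is
      orthogonal to every \<open>b j\<close> in the inner product of \<open>A\<close>, and only has
      to be normalised.\<close>
    have "dim ((\<lambda>j. A *v b j) ` S) \<le> card S"
      using dim_le_card'[of "(\<lambda>j. A *v b j) ` S"] card_image_le[of S "\<lambda>j. A *v b j"] 2(1) by simp
    also have "card S < CARD('n)"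
      using 2(2) by (intro psubset_card_mono) auto
    finally have "dim ((\<lambda>j. A *v b j) ` S) < DIM(real^'n)"
      by simp
    then obtain x where x: "x \<noteq> 0" "\<And>y. y \<in> span ((\<lambda>j. A *v b j) ` S) \<Longrightarrow> orthogonal x y"
      using orthogonal_to_subspace_exists by blast
    have xb: "x \<bullet> (A *v b j) = 0" if "j \<in> S" for j
      using x(2)[OF span_base] that by (auto simp: orthogonal_def)
    have pos: "0 < x \<bullet> (A *v x)"
      using A x(1) by (simp add: pos_def_def)
    define v where "v = (1 / sqrt (x \<bullet> (A *v x))) *\<^sub>R x"
    have vv: "v \<bullet> (A *v v) = 1"
      using pos by (simp add: v_def matrix_vector_mult_scaleR)
    have vb: "v \<bullet> (A *v b j) = 0" if "j \<in> S" for j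
      using xb[OF that] by (simp add: v_def)
    have bv: "b j \<bullet> (A *v v) = 0" if "j \<in> S" for j
      using vb[OF that] sym[of v "b j"] by simp
    have "\<forall>i'\<in>insert i S. \<forall>j\<in>insert i S. (b(i := v)) i' \<bullet> (A *v (b(i := v)) j) = (if i' = j then 1 else 0)"
    proof (intro ballI)
      fix i' j assume "i' \<in> insert i S" "j \<in> insert i S"
      then show "(b(i := v)) i' \<bullet> (A *v (b(i := v)) j) = (if i' = j then 1 else 0)"
        by (cases "i' = i"; cases "j = i") (use 2(2) in \<open>simp_all add: b vv vb bv\<close>)
    qed
    then show ?case by (rule exI[of _ "b(i := v)"])
  qed simp
  from this[of UNIV] obtain b :: "'n \<Rightarrow> real^'n"
    where b: "\<And>i j. b i \<bullet> (A *v b j) = (if i = j then 1 else 0)"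
    by auto
  define B where "B = (\<chi> i j. b j $ i)"
  have "(transpose B ** A ** B) $ i $ j = b i \<bullet> (A *v b j)" for i j
    unfolding matrix_mul_assoc[symmetric]
    by (simp add: B_def transpose_def matrix_matrix_mult_def inner_vec_def matrix_vector_mult_def)
  then have "transpose B ** A ** B = mat 1"
    by (simp add: vec_eq_iff b mat_def)
  then show thesis
    by (rule that)
qed

section \<open>Determinants under congruence and rank-one updates\<close>

lemma det_congruent_mat1:
  fixes A :: "real^'n::finite^'n"
  assumes "transpose B ** A ** B = mat 1"
  shows "(det B)\<^sup>2 * det A = 1"
  using arg_cong[OF assms, of det] by (simp add: det_mul det_transpose power2_eq_square ac_simps)

lemma det_pos_def_pos:
  fixes A :: "real^'n::finite^'n"
  assumes "pos_def A"
  shows "0 < det A"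
proof -
  obtain B :: "real^'n^'n" where "transpose B ** A ** B = mat 1"
    using pos_def_congruent_mat1[OF assms] .
  then have "(det B)\<^sup>2 * det A = 1"
    by (rule det_congruent_mat1)
  then show ?thesis
    by (metis zero_less_mult_pos zero_less_one zero_less_power2 mult_zero_left zero_power2 zero_neq_one)
qed

text \<open>An orthogonal change of basis carries a coordinate axis to the direction of
  \<open>w\<close>. In that basis the matrix is diagonal, with one entry
  \<open>1 + w \<bullet> w\<close> and all others 1.\<close>

lemma det_mat1_plus_outer: "det (mat 1 + outer w) = 1 + w \<bullet> w" for w :: "real^'n::finite"
proof (cases "w = 0")
  case True
  then show ?thesis
    by (simp add: outer_def vec_eq_iff zero_vec_def[symmetric])
next
  case False
  fix k :: 'n
  have "norm (w /\<^sub>R norm w) = 1"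
    using False by simp
  then obtain R where R: "orthogonal_matrix R" "R *v axis k 1 = w /\<^sub>R norm w"
    using orthogonal_matrix_exists_basis by metis
  then have w: "w = R *v axis k (norm w)"
  proof -
    have "axis k (norm w) = norm w *\<^sub>R (axis k 1 :: real^'n)"
      by (simp add: axis_def vec_eq_iff)
    then show ?thesis
      using R(2) False by (simp add: matrix_vector_mult_scaleR)
  qed
  let ?D = "mat 1 + outer (axis k (norm w)) :: real^'n^'n"
  have "mat 1 + outer w = R ** ?D ** transpose R"
    using R(1)
    by (subst w, simp add: outer_matrix_vector matrix_add_ldistrib matrix_add_rdistrib orthogonal_matrix_def)
  moreover have "det R * det R = 1"
    using det_orthogonal_matrix[OF R(1)] by auto
  ultimately have "det (mat 1 + outer w) = det ?D"
    by (simp add: det_mul det_transpose)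
  also have "\<dots> = (\<Prod>i\<in>UNIV. ?D $ i $ i)"
    by (rule det_diagonal) (auto simp: mat_def outer_def axis_def)
  also have "\<dots> = (\<Prod>i\<in>UNIV. if i = k then 1 + w \<bullet> w else 1)"
    by (rule prod.cong) (auto simp: mat_def outer_def axis_def dot_square_norm power2_eq_square)
  also have "\<dots> = 1 + w \<bullet> w"
    by simp
  finally show ?thesis .
qed

text \<open>Congruence by \<open>B\<close> turns \<open>A\<close> into the identity and
  \<open>v\<close> into \<open>transpose B *v v\<close>. The factor \<open>(det B)\<^sup>2\<close>
  that it introduces is the inverse of \<open>det A\<close>.\<close>

lemma det_plus_outer:
  fixes A B :: "real^'n::finite^'n"
  assumes "transpose B ** A ** B = mat 1"
  shows "det (A + outer v) = det A * (1 + (transpose B *v v) \<bullet> (transpose B *v v))"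
proof -
  let ?w = "transpose B *v v"
  have "outer ?w = transpose B ** outer v ** B"
    using outer_matrix_vector[of "transpose B" v] by (simp only: transpose_transpose)
  then have "transpose B ** (A + outer v) ** B = mat 1 + outer ?w"
    by (simp only: matrix_add_ldistrib matrix_add_rdistrib assms)
  from arg_cong[OF this, of det] have *: "(det B)\<^sup>2 * det (A + outer v) = 1 + ?w \<bullet> ?w"
    by (simp only: det_mul det_transpose det_mat1_plus_outer power2_eq_square ac_simps)
  have "det (A + outer v) = ((det B)\<^sup>2 * det A) * det (A + outer v)"
    using det_congruent_mat1[OF assms] by (simp only: mult_1_left)
  also have "\<dots> = det A * ((det B)\<^sup>2 * det (A + outer v))"
    by (simp only: ac_simps)
  finally show ?thesis
    by (simp only: *)
qed

section \<open>The radial integral\<close>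

text \<open>The space, and with it the dimension, is passed as a type argument because
  \<open>s\<close> does not determine it.\<close>

definition radial_integral :: "'a::euclidean_space itself \<Rightarrow> real \<Rightarrow> ennreal" where
  "radial_integral _ s = (\<integral>\<^sup>+u. ennreal ((1 + u \<bullet> u) powr (- s / 2)) \<partial>(lborel :: 'a measure))"

text \<open>The integrand is positive everywhere. This is needed because
  \<open>0 * \<infinity> = 0\<close> in \<open>ennreal\<close>: a vanishing factor would hide the
  divergence of another one.\<close>

lemma radial_integral_pos: "radial_integral TYPE('a::euclidean_space) s \<noteq> 0"
proof
  assume "radial_integral TYPE('a) s = 0"
  then have AE: "AE u::'a in lborel. ennreal ((1 + u \<bullet> u) powr (- s / 2)) = 0"
    unfolding radial_integral_def by (subst (asm) nn_integral_0_iff_AE) auto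
  have "0 < 1 + u \<bullet> u" for u :: 'a
    by (simp add: add_pos_nonneg)
  then have "ennreal ((1 + u \<bullet> u) powr (- s / 2)) \<noteq> 0" for u :: 'a
    by (metis ennreal_eq_0_iff not_le powr_gt_zero less_irrefl)
  then have "AE u::'a in lborel. False"
    using AE by simp
  then show False
    by (simp add: eventually_False ae_filter_eq_bot_iff)
qed

text \<open>The integrand is dominated by a weighted sum of indicators of the balls of radius
  \<open>2 ^ j\<close>. Weight times volume is a geometric sequence with ratio
  \<open>2 powr (real DIM('a) - s)\<close>, which is below 1.\<close>

lemma radial_integral_finite:
  assumes s: "real DIM('a::euclidean_space) < s"
  shows "radial_integral TYPE('a) s < \<infinity>"
proof -
  have pw: "(2 powr a) ^ j = 2 powr (a * real j)" for a :: real and j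
    by (simp add: powr_realpow[symmetric] powr_powr)
  define V where "V = unit_ball_vol (real DIM('a))"
  have V: "0 \<le> V"
    by (simp add: V_def)
  have s0: "0 < s"
    using s by (meson of_nat_0_le_iff le_less_trans)
  \<comment> \<open>The weight is \<open>2 powr (2 * (real j - 1))\<close> raised to the power
    \<open>- s / 2\<close>, a bound for the integrand where the norm is at least
    \<open>2 powr (real j - 1)\<close>. It is spread over the whole ball, whose volume is
    explicit.\<close>
  define g where "g j u = ennreal (2 powr s * (2 powr - s) ^ j) * indicator (ball 0 (2 ^ j)) u"
    for j and u :: 'a
  have g [measurable]: "g j \<in> borel_measurable borel" for j
    unfolding g_def by (intro borel_measurable_times_ennreal borel_measurable_const borel_measurable_indicator) simp
  have le: "ennreal ((1 + u \<bullet> u) powr (- s / 2)) \<le> (\<Sum>j. g j u)" for u :: 'a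
  proof -
    \<comment> \<open>The least such \<open>j\<close> puts \<open>u\<close> inside the ball number
      \<open>j\<close> but, for positive \<open>j\<close>, outside the preceding one. For
      \<open>j = 0\<close> the lower bound below is 1/4, which holds trivially.\<close>
    define j where "j = (LEAST j. norm u < 2 ^ j)"
    have j: "norm u < 2 ^ j"
      unfolding j_def using real_arch_pow[of 2 "norm u"] by (auto intro: LeastI_ex)
    have "2 powr (2 * (real j - 1)) \<le> 1 + u \<bullet> u"
    proof (cases j)
      case 0
      have "2 powr (- 2 :: real) \<le> 1"
        by (simp add: powr_minus)
      also have "1 \<le> 1 + u \<bullet> u"
        by simp
      finally show ?thesis
        using 0 by simp
    next
      case (Suc i)
      then have "2 ^ i \<le> norm u"
        using not_less_Least[of i "\<lambda>j. norm u < 2 ^ j"] by (simp add: j_def)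
      then have "(2 ^ i)\<^sup>2 \<le> u \<bullet> u"
        by (simp add: dot_square_norm power_mono)
      moreover have "2 powr (2 * (real j - 1)) = (2 ^ i)\<^sup>2"
      proof -
        have "2 * (real j - 1) = real (2 * i)"
          using Suc by simp
        then show ?thesis
          by (simp only: powr_realpow power_even_eq zero_less_numeral)
      qed
      ultimately show ?thesis
        by simp
    qed
    then have "(1 + u \<bullet> u) powr (- s / 2) \<le> (2 powr (2 * (real j - 1))) powr (- s / 2)"
      using s0 by (intro powr_mono2') auto
    also have "\<dots> = 2 powr s * (2 powr - s) ^ j"
    proof -
      have "2 * (real j - 1) * (- s / 2) = s + - s * real j"
        by (simp add: field_simps)
      then show ?thesis
        by (simp only: powr_powr powr_add pw)
    qed
    finally have "ennreal ((1 + u \<bullet> u) powr (- s / 2)) \<le> g j u"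
      using j by (simp add: g_def ennreal_leI)
    also have "\<dots> \<le> (\<Sum>j. g j u)"
      using sum_le_suminf[of "\<lambda>j. g j u" "{j}"] by simp
    finally show ?thesis .
  qed
  have "(2 powr - s) ^ j * (2 ^ j) ^ DIM('a) = (2 powr (real DIM('a) - s)) ^ j" for j
  proof -
    have "(2 ^ j) ^ DIM('a) = 2 powr (real DIM('a) * real j)"
      by (simp add: powr_realpow flip: power_mult of_nat_mult)
    then show ?thesis
      by (simp add: pw left_diff_distrib flip: powr_add)
  qed
  then have geo: "2 powr s * (2 powr - s) ^ j * (V * (2 ^ j) ^ DIM('a))
      = 2 powr s * V * (2 powr (real DIM('a) - s)) ^ j" for j
    by (simp add: ac_simps)
  have int: "(\<integral>\<^sup>+u. g j u \<partial>lborel) = ennreal (2 powr s * V * (2 powr (real DIM('a) - s)) ^ j)" for j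
  proof -
    have "(\<integral>\<^sup>+u. g j u \<partial>lborel)
        = ennreal (2 powr s * (2 powr - s) ^ j) * emeasure lborel (ball (0 :: 'a) (2 ^ j))"
      by (simp add: g_def nn_integral_cmult_indicator)
    also have "\<dots> = ennreal (2 powr s * (2 powr - s) ^ j * (V * (2 ^ j) ^ DIM('a)))"
      using V by (simp add: emeasure_ball V_def ennreal_mult[symmetric])
    finally show ?thesis
      by (simp only: geo)
  qed
  have "radial_integral TYPE('a) s \<le> (\<integral>\<^sup>+u. (\<Sum>j. g j u) \<partial>lborel)"
    unfolding radial_integral_def by (intro nn_integral_mono le)
  also have "\<dots> = (\<Sum>j. \<integral>\<^sup>+u. g j u \<partial>lborel)"
    by (rule nn_integral_suminf) simp
  also have "\<dots> = ennreal (\<Sum>j. 2 powr s * V * (2 powr (real DIM('a) - s)) ^ j)"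
  proof -
    have "2 powr (real DIM('a) - s) < 2 powr 0"
      using s by (intro powr_less_mono) auto
    then show ?thesis
      unfolding int using V by (intro suminf_ennreal2) (auto intro!: summable_mult summable_geometric)
  qed
  also have "\<dots> < \<infinity>"
    by simp
  finally show ?thesis .
qed

text \<open>At the critical exponent a dilation replaces \<open>1 + |u|\<^sup>2\<close> by \<open>4 + |u|\<^sup>2\<close> without changing the
  integral, although the integrand gets smaller everywhere.\<close>

lemma radial_integral_infinite:
  "radial_integral TYPE('a::euclidean_space) (real DIM('a)) = \<infinity>"
proof (rule ccontr)
  assume fin: "radial_integral TYPE('a) (real DIM('a)) \<noteq> \<infinity>"
  define p where "p = - real DIM('a) / 2"
  define F where "F c = (\<integral>\<^sup>+u. ennreal ((c + u \<bullet> u) powr p) \<partial>(lborel :: 'a measure))" for c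
  have lb: "lborel = density (distr lborel borel (\<lambda>x::'a. 2 *\<^sub>R x)) (\<lambda>_. ennreal (2 ^ DIM('a)))"
    using lborel_affine[of 2 "0::'a"] by simp
  have "F 4 = ennreal (2 ^ DIM('a)) * (\<integral>\<^sup>+u. ennreal ((4 + (2 *\<^sub>R u) \<bullet> (2 *\<^sub>R u)) powr p) \<partial>(lborel :: 'a measure))"
    unfolding F_def by (subst lb) (simp add: nn_integral_density nn_integral_distr nn_integral_cmult)
  also have "\<dots> = F 1"
    unfolding F_def
  proof (subst nn_integral_cmult[symmetric], simp, intro nn_integral_cong)
    fix u :: 'a
    have "(4 + (2 *\<^sub>R u) \<bullet> (2 *\<^sub>R u)) powr p = (4 * (1 + u \<bullet> u)) powr p"
      by (simp add: algebra_simps)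
    also have "\<dots> = 4 powr p * (1 + u \<bullet> u) powr p"
      by (subst powr_mult) auto
    \<comment> \<open>Here the exponent is critical: the factor pulled out of the power cancels the
      Jacobian \<open>2 ^ DIM('a)\<close> exactly.\<close>
    also have "4 powr p = 1 / 2 ^ DIM('a)"
      using powr_powr[of 2 2 p] by (simp add: p_def powr_minus_divide powr_realpow)
    finally show "ennreal (2 ^ DIM('a)) * ennreal ((4 + (2 *\<^sub>R u) \<bullet> (2 *\<^sub>R u)) powr p)
        = ennreal ((1 + u \<bullet> u) powr p)"
      by (simp add: ennreal_mult[symmetric])
  qed
  finally have eq: "F 4 = F 1" .
  have less: "(4 + u \<bullet> u) powr p < (1 + u \<bullet> u) powr p" for u :: 'a
    by (intro powr_less_mono2_neg) (auto simp: p_def add_pos_nonneg)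
  \<comment> \<open>A strict pointwise inequality passes to the integrals only if the smaller
    integral is finite; this is where the assumed finiteness enters.\<close>
  have "F 4 < F 1"
    unfolding F_def
  proof (rule nn_integral_less)
    have "F 1 \<noteq> \<infinity>"
      using fin by (simp add: F_def radial_integral_def p_def)
    then show "(\<integral>\<^sup>+u. ennreal ((4 + u \<bullet> u) powr p) \<partial>(lborel :: 'a measure)) \<noteq> \<infinity>"
      using eq by (simp add: F_def)
    show "AE u::'a in lborel. ennreal ((4 + u \<bullet> u) powr p) \<le> ennreal ((1 + u \<bullet> u) powr p)"
      using less by (intro AE_I2 ennreal_leI less_imp_le)
    have "\<not> ennreal ((1 + u \<bullet> u) powr p) \<le> ennreal ((4 + u \<bullet> u) powr p)" for u :: 'a
      using less[of u] by (simp add: not_le ennreal_less_iff)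
    then show "\<not> (AE u::'a in lborel. ennreal ((1 + u \<bullet> u) powr p) \<le> ennreal ((4 + u \<bullet> u) powr p))"
      by (simp add: eventually_False ae_filter_eq_bot_iff)
  qed auto
  then show False
    using eq by simp
qed

section \<open>Integration over the rows\<close>

lemma borel_measurable_det:
  fixes A :: "'a \<Rightarrow> real^'n::finite^'n"
  assumes "\<And>i j. (\<lambda>x. A x $ i $ j) \<in> borel_measurable M"
  shows "(\<lambda>x. det (A x)) \<in> borel_measurable M"
  unfolding det_def
  by (intro borel_measurable_sum borel_measurable_times borel_measurable_const borel_measurable_prod assms)

text \<open>This is the integration over one row. \<open>A\<close> is a general positive definite
  matrix because it will already contain the contributions of the other rows.\<close>

lemma nn_integral_det_plus_outer:
  fixes A :: "real^'n::finite^'n"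
  assumes A: "pos_def A"
  shows "(\<integral>\<^sup>+v. ennreal (det (A + outer v) powr (- s / 2)) \<partial>lborel)
    = ennreal (det A powr (- (s - 1) / 2)) * radial_integral TYPE(real^'n) s"
proof -
  obtain B :: "real^'n^'n" where B: "transpose B ** A ** B = mat 1"
    using pos_def_congruent_mat1[OF A] .
  note BA = det_congruent_mat1[OF B]
  have d: "0 < det A"
    using det_pos_def_pos[OF A] .
  define f where "f v = transpose B *v v" for v
  define h where "h u = ennreal ((1 + u \<bullet> u) powr (- s / 2))" for u :: "real^'n"
  define J where "J = (\<integral>\<^sup>+v. h (f v) \<partial>lborel)"
  have h: "h \<in> borel_measurable borel"
    unfolding h_def by measurable
  have lin: "linear f"
    unfolding f_def by (rule matrix_vector_mul_linear)
  have mf: "det (matrix f) = det B"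
    unfolding f_def by (subst matrix_of_matrix_vector_mul) (rule det_transpose)
  have "det B \<noteq> 0"
    using BA by auto
  then have J: "ennreal \<bar>det B\<bar> * J = radial_integral TYPE(real^'n) s"
    using nn_integral_lborel_linear[OF lin _ h] by (simp add: mf J_def h_def radial_integral_def)
  have "sqrt ((det B)\<^sup>2 * det A) = 1"
    using BA by simp
  then have Bd: "\<bar>det B\<bar> * sqrt (det A) = 1"
    by (simp add: real_sqrt_mult)
  have "- (s - 1) / 2 = - s / 2 + 1 / 2"
    by (simp add: field_simps)
  then have "det A powr (- (s - 1) / 2) = det A powr (- s / 2) * sqrt (det A)"
    using d by (simp only: powr_add) (simp add: powr_half_sqrt)
  \<comment> \<open>By congruence \<open>\<bar>det B\<bar>\<close> is the inverse square root of
    \<open>det A\<close>, so the Jacobian of the substitution is what lowers the exponent from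
    \<open>s\<close> to \<open>s - 1\<close>.\<close>
  then have key: "det A powr (- (s - 1) / 2) * \<bar>det B\<bar> = det A powr (- s / 2)"
    using Bd by (simp add: ac_simps)
  have "ennreal (det (A + outer v) powr (- s / 2)) = ennreal (det A powr (- s / 2)) * h (f v)" for v
  proof -
    have "det (A + outer v) = det A * (1 + f v \<bullet> f v)"
      unfolding f_def by (rule det_plus_outer[OF B])
    then show ?thesis
      using d by (simp add: h_def powr_mult ennreal_mult[symmetric])
  qed
  then have "(\<integral>\<^sup>+v. ennreal (det (A + outer v) powr (- s / 2)) \<partial>lborel)
      = (\<integral>\<^sup>+v. ennreal (det A powr (- s / 2)) * h (f v) \<partial>lborel)"
    by simp
  also have "\<dots> = ennreal (det A powr (- s / 2)) * J"
  proof -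
    have "f \<in> borel_measurable borel"
      using lin by (intro borel_measurable_continuous_onI linear_continuous_on)
        (simp add: linear_conv_bounded_linear)
    from measurable_compose[OF this h] show ?thesis
      unfolding J_def by (intro nn_integral_cmult) simp
  qed
  also have "\<dots> = ennreal (det A powr (- (s - 1) / 2)) * (ennreal \<bar>det B\<bar> * J)"
    by (subst key[symmetric]) (simp add: ennreal_mult mult.assoc)
  finally show ?thesis
    by (simp only: J)
qed

text \<open>The inserted row is integrated first, with the other rows absorbed into the base matrix.
  This produces a constant and leaves the same kind of integral at \<open>s - 1\<close>, so
  \<open>s\<close> has to vary in the induction.\<close>

lemma nn_integral_det_plus_sum_outer:
  fixes A :: "real^'n::finite^'n"
  assumes "finite I" and A: "pos_def A"
  shows "(\<integral>\<^sup>+v. ennreal (det (A + (\<Sum>i\<in>I. outer (v i))) powr (- s / 2)) \<partial>Pi\<^sub>M I (\<lambda>_. lborel))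
    = ennreal (det A powr (- (s - real (card I)) / 2))
      * (\<Prod>j<card I. radial_integral TYPE(real^'n) (s - real j))"
  using assms(1)
proof (induction arbitrary: s)
  case empty
  interpret product_sigma_finite "\<lambda>_. lborel :: (real^'n) measure" ..
  show ?case
    by (simp add: PiM_empty nn_integral_count_space_finite)
next
  case (insert i I)
  interpret product_sigma_finite "\<lambda>_. lborel :: (real^'n) measure" ..
  let ?S = "\<lambda>I v. A + (\<Sum>i\<in>I. outer (v i))"
  have meas: "(\<lambda>v. ennreal (det (?S J v) powr p)) \<in> borel_measurable (Pi\<^sub>M K (\<lambda>_. lborel))"
    if "J \<subseteq> K" for J K p
  proof -
    have "(\<lambda>v. det (?S J v)) \<in> borel_measurable (Pi\<^sub>M K (\<lambda>_. lborel))"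
    proof (rule borel_measurable_det)
      fix a b
      have "(\<lambda>v. v j $ c :: real) \<in> borel_measurable (Pi\<^sub>M K (\<lambda>_. lborel))" if "j \<in> J" for j and c :: 'n
      proof -
        have "(\<lambda>v. v j) \<in> measurable (Pi\<^sub>M K (\<lambda>_. lborel)) (lborel :: (real^'n) measure)"
          using that \<open>J \<subseteq> K\<close> by (intro measurable_component_singleton) auto
        from measurable_compose[OF this, of "\<lambda>v. v $ c" borel] show ?thesis
          by simp
      qed
      then show "(\<lambda>v. ?S J v $ a $ b) \<in> borel_measurable (Pi\<^sub>M K (\<lambda>_. lborel))"
        by (simp add: outer_def)
    qed
    then show ?thesis
      by measurable
  qed
  have upd: "?S (insert i I) (x(i := y)) = ?S I x + outer y" for x y
  proof -
    have "(\<Sum>j\<in>I. outer ((x(i := y)) j)) = (\<Sum>j\<in>I. outer (x j))"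
      using insert.hyps by (intro sum.cong) auto
    then show ?thesis
      using insert.hyps by (simp add: ac_simps)
  qed
  have "(\<integral>\<^sup>+v. ennreal (det (?S (insert i I) v) powr (- s / 2)) \<partial>Pi\<^sub>M (insert i I) (\<lambda>_. lborel))
      = (\<integral>\<^sup>+x. \<integral>\<^sup>+y. ennreal (det (?S I x + outer y) powr (- s / 2)) \<partial>lborel \<partial>Pi\<^sub>M I (\<lambda>_. lborel))"
    unfolding product_nn_integral_insert[OF insert.hyps meas[OF subset_refl]] upd ..
  also have "\<dots> = (\<integral>\<^sup>+x. ennreal (det (?S I x) powr (- (s - 1) / 2)) * radial_integral TYPE(real^'n) s
      \<partial>Pi\<^sub>M I (\<lambda>_. lborel))"
    using pos_def_plus_sum_outer[OF A insert.hyps(1)] by (simp only: nn_integral_det_plus_outer)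
  also have "\<dots> = ennreal (det A powr (- (s - 1 - real (card I)) / 2))
      * (\<Prod>j<card I. radial_integral TYPE(real^'n) (s - 1 - real j)) * radial_integral TYPE(real^'n) s"
    by (simp only: nn_integral_multc[OF meas[OF subset_refl]] insert.IH)
  \<comment> \<open>The inserted row supplies the factor with index 0; the factors from the
    induction hypothesis move from index \<open>j\<close> to \<open>j + 1\<close>.\<close>
  also have "\<dots> = ennreal (det A powr (- (s - real (card (insert i I))) / 2))
      * (\<Prod>j<card (insert i I). radial_integral TYPE(real^'n) (s - real j))"
    using insert.hyps by (simp add: prod.lessThan_Suc_shift ac_simps diff_diff_eq del: prod.lessThan_Suc)
  finally show ?case .
qed

section \<open>Gram determinants along the planes of integration\<close>

lemma transpose_vstack_mult_vstack:
  fixes \<omega> :: "real^'m^'k::finite" and t :: "real^'m^'l::finite"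
  shows "transpose (vstack \<omega> t) ** vstack \<omega> t = transpose t ** t + transpose \<omega> ** \<omega>"
  by (simp add: transpose_mult_self sum_UNIV_Plus vstack_def add.commute)

text \<open>The orthogonal \<open>g\<close> cancels in the Gram matrix. The fixed block
  \<open>t\<close> goes into the base matrix, and the rows of \<open>\<omega>\<close> are the
  rank-one terms to be integrated out.\<close>

lemma nn_integral_gram_vstack:
  fixes g :: "real^('k::finite + 'l::finite)^('k + 'l)" and t :: "real^'m::finite^'l"
  assumes g: "orthogonal_matrix g"
  defines "x \<equiv> \<lambda>\<omega> :: real^'m^'k. g ** vstack \<omega> t"
  shows "(\<integral>\<^sup>+\<omega>. ennreal (det (mat 1 + transpose (x \<omega>) ** x \<omega>) powr (- s / 2)) \<partial>lborel)
    = ennreal (det (mat 1 + transpose t ** t) powr (- (s - real CARD('k)) / 2))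
      * (\<Prod>j<CARD('k). radial_integral TYPE(real^'m) (s - real j))"
proof -
  let ?A = "mat 1 + transpose t ** t"
  have gram: "transpose (x \<omega>) ** x \<omega> = transpose t ** t + (\<Sum>i\<in>UNIV. outer (\<omega> $ i))" for \<omega>
  proof -
    have "transpose (x \<omega>) ** x \<omega> = transpose (vstack \<omega> t) ** (transpose g ** g) ** vstack \<omega> t"
      by (simp add: x_def matrix_transpose_mul matrix_mul_assoc)
    then show ?thesis
      using g by (simp add: orthogonal_matrix transpose_vstack_mult_vstack transpose_mult_self[of \<omega>])
  qed
  have meas: "(\<lambda>\<omega> :: real^'m^'k. ennreal (det (?A + (\<Sum>i\<in>UNIV. outer (\<omega> $ i))) powr (- s / 2)))
      \<in> borel_measurable borel"
  proof -
    have "(\<lambda>\<omega> :: real^'m^'k. det (?A + (\<Sum>i\<in>UNIV. outer (\<omega> $ i)))) \<in> borel_measurable borel"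
      by (rule borel_measurable_det, rule borel_measurable_continuous_onI)
        (auto simp: outer_def intro!: continuous_intros)
    then show ?thesis
      by measurable
  qed
  have "(\<integral>\<^sup>+\<omega>. ennreal (det (mat 1 + transpose (x \<omega>) ** x \<omega>) powr (- s / 2)) \<partial>lborel)
      = (\<integral>\<^sup>+\<omega>. ennreal (det (?A + (\<Sum>i\<in>UNIV. outer (\<omega> $ i))) powr (- s / 2))
          \<partial>(lborel :: (real^'m^'k) measure))"
    by (simp only: gram add.assoc)
  also have "\<dots> = (\<integral>\<^sup>+v. ennreal (det (?A + (\<Sum>i\<in>UNIV. outer (v i))) powr (- s / 2))
      \<partial>Pi\<^sub>M (UNIV :: 'k set) (\<lambda>_. lborel))"
    by (subst nn_integral_lborel_vec[OF meas]) simp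
  finally show ?thesis
    by (simp only: nn_integral_det_plus_sum_outer[OF finite pos_def_mat1_plus_gram])
qed

lemma one_le_det_mat1_plus_gram: "1 \<le> det (mat 1 + transpose x ** x)"
  for x :: "real^'m::finite^'k::finite"
proof -
  have "1 \<le> det (mat 1 + (\<Sum>i\<in>I. outer (x $ i)))" if "finite I" for I
    using that
  proof induction
    case (insert i I)
    let ?A = "mat 1 + (\<Sum>i\<in>I. outer (x $ i))"
    have pd: "pos_def ?A"
      using insert.hyps by (simp add: pos_def_plus_sum_outer pos_def_mat1)
    then obtain B :: "real^'m^'m" where "transpose B ** ?A ** B = mat 1"
      using pos_def_congruent_mat1 by blast
    from det_plus_outer[OF this, of "x $ i"] have "det ?A * 1 \<le> det (?A + outer (x $ i))"
      using det_pos_def_pos[OF pd] by (metis inner_ge_zero le_add_same_cancel1 mult_left_mono less_imp_le)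
    then show ?case
      using insert by (simp add: ac_simps)
  qed simp
  then show ?thesis
    by (simp add: transpose_mult_self)
qed

section \<open>Continuity of the comparison function and a global form of the decay
  condition\<close>

lemma continuous_on_det_gram:
  "continuous_on UNIV (\<lambda>x :: real^'m::finite^'k::finite. det (mat 1 + transpose x ** x))"
  unfolding det_def matrix_matrix_mult_def transpose_def
  by (intro continuous_intros)

lemma continuous_on_gram_powr:
  "continuous_on UNIV (\<lambda>x :: real^'m::finite^'k::finite. det (mat 1 + transpose x ** x) powr p)"
proof (intro continuous_on_powr continuous_on_det_gram continuous_on_const ballI)
  show "det (mat 1 + transpose x ** x) \<noteq> 0" for x :: "real^'m^'k"
    using one_le_det_mat1_plus_gram[of x] by linarith
qed

text \<open>Far out the bound is the decay condition itself. On the remaining ball the quotient of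
  \<open>norm (f x)\<close> by the positive comparison function is continuous, hence bounded by
  compactness.\<close>

lemma matrix_decay_bound:
  fixes f :: "real^'m::finite^'n::finite \<Rightarrow> 'b::real_normed_field"
  assumes f: "continuous_on UNIV f" and "matrix_decay s f"
  obtains C where "0 \<le> C" "\<And>x. norm (f x) \<le> C * det (mat 1 + transpose x ** x) powr (- s / 2)"
proof -
  define w where "w x = det (mat 1 + transpose x ** x) powr (- s / 2)" for x :: "real^'m^'n"
  have w: "0 < w x" for x
    using one_le_det_mat1_plus_gram[of x] by (simp add: w_def)
  have abs: "\<bar>det (mat 1 + transpose x ** x)\<bar> powr (- s / 2) = w x" for x
    using one_le_det_mat1_plus_gram[of x] by (simp add: w_def)
  have "f \<in> O[at_infinity](\<lambda>x. of_real (w x))"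
    using assms(2) unfolding matrix_decay_def by (simp only: abs)
  then obtain c where "eventually (\<lambda>x. norm (f x) \<le> c * norm (of_real (w x) :: 'b)) at_infinity"
    by (elim landau_o.bigE) auto
  then have "eventually (\<lambda>x. norm (f x) \<le> c * w x) at_infinity"
    using w by (simp add: less_imp_le)
  then obtain r where r: "\<And>x. r \<le> norm x \<Longrightarrow> norm (f x) \<le> c * w x"
    by (auto simp: eventually_at_infinity)
  have "continuous_on (cball 0 r) (\<lambda>x. norm (f x) / w x)"
  proof (intro continuous_on_divide continuous_on_norm continuous_on_subset[OF f] ballI)
    show "continuous_on (cball 0 r) w"
      unfolding w_def[abs_def] by (rule continuous_on_subset[OF continuous_on_gram_powr]) simp
    show "w x \<noteq> 0" for x
      using w[of x] by simp
  qed simp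
  then have "bounded ((\<lambda>x. norm (f x) / w x) ` cball 0 r)"
    by (intro compact_imp_bounded compact_continuous_image) auto
  then obtain b where b: "\<forall>x\<in>cball 0 r. \<bar>norm (f x) / w x\<bar> \<le> b"
    by (auto simp: bounded_iff)
  \<comment> \<open>\<open>b\<close> serves the ball and \<open>c\<close> its outside; the 0 makes
    the constant nonnegative, so that it can be moved into \<open>ennreal\<close> as a
    factor.\<close>
  have "norm (f x) \<le> max 0 (max b c) * w x" for x
  proof (cases "r \<le> norm x")
    case True
    then show ?thesis
      using r[of x] w[of x] by (meson max.cobounded2 mult_right_mono less_imp_le order_trans)
  next
    case False
    then have "norm (f x) / w x \<le> b"
      using b[rule_format, of x] w[of x] by auto
    then have "norm (f x) \<le> b * w x"
      using w[of x] by (simp add: field_simps)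
    also have "\<dots> \<le> max 0 (max b c) * w x"
      using w[of x] by (intro mult_right_mono) auto
    finally show ?thesis .
  qed
  then show thesis
    using that[of "max 0 (max b c)"] by (simp add: w_def)
qed

text \<open>The infinite factor is split off; the product of the others is nonzero, so it cannot
  annihilate it.\<close>

lemma prod_ennreal_eq_top:
  fixes h :: "'i \<Rightarrow> ennreal"
  assumes "finite I" "i \<in> I" "h i = top" "\<And>j. j \<in> I \<Longrightarrow> h j \<noteq> 0"
  shows "prod h I = top"
proof -
  have "prod h (I - {i}) \<noteq> 0"
    using assms by simp
  then show ?thesis
    using assms by (simp add: prod.remove ennreal_top_mult)
qed

section \<open>Convergence above the critical exponent, divergence at and below it\<close>

theorem theorem4p25:
  assumes "CARD('m::finite) \<le> CARD('k::finite + 'l::finite)"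
  shows "(\<forall>lam::real. lam > real CARD('k) + real CARD('m) - 1 \<longrightarrow>
            (\<forall>f :: real^'m^('k + 'l) \<Rightarrow> complex.
               continuous_on UNIV f \<and> matrix_decay lam f \<longrightarrow>
               (\<forall>\<xi>\<in>stiefel. \<forall>t. radon_transform_finite f \<xi> t)))
       \<and> (\<forall>lam::real. lam \<le> real CARD('k) + real CARD('m) - 1 \<longrightarrow>
            (\<exists>f :: real^'m^('k + 'l) \<Rightarrow> real.
               continuous_on UNIV f \<and> (\<forall>x. 0 \<le> f x) \<and> matrix_decay lam f \<and>
               (\<forall>\<xi>\<in>stiefel. \<forall>t. radon_transform_nonneg f \<xi> t = \<infinity>)))"
proof (intro conjI allI impI ballI)
  fix lam and f :: "real^'m^('k + 'l) \<Rightarrow> complex" and \<xi> :: "real^'l^('k + 'l)" and t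
  assume lam: "lam > real CARD('k) + real CARD('m) - 1"
    and f: "continuous_on UNIV f \<and> matrix_decay lam f" and \<xi>: "\<xi> \<in> stiefel"
  obtain C where C: "0 \<le> C" "\<And>x. norm (f x) \<le> C * det (mat 1 + transpose x ** x) powr (- lam / 2)"
    using matrix_decay_bound f by blast
  let ?x = "\<lambda>\<omega> :: real^'m^'k. frame_rotation \<xi> ** vstack \<omega> t"
  let ?w = "\<lambda>x :: real^'m^('k + 'l). ennreal (det (mat 1 + transpose x ** x) powr (- lam / 2))"
  have o: "orthogonal_matrix (frame_rotation \<xi>)"
    using frame_rotation[OF \<xi>] by (simp add: is_frame_rotation_def rotation_matrix_def)
  have wm: "?w \<in> borel_measurable borel"
    using continuous_on_gram_powr by (intro measurable_compose[OF _ measurable_ennreal] borel_measurable_continuous_onI)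
  show "radon_transform_finite f \<xi> t"
    unfolding radon_transform_finite_def radon_integrand_def[abs_def]
  proof (rule integrableI_bounded)
    show "(\<lambda>\<omega>. f (?x \<omega>)) \<in> borel_measurable lborel"
      using measurable_vstack[OF borel_measurable_continuous_onI, of f "frame_rotation \<xi>" t] f by simp
    have "(\<integral>\<^sup>+\<omega>. ennreal (norm (f (?x \<omega>))) \<partial>lborel) \<le> (\<integral>\<^sup>+\<omega>. ennreal C * ?w (?x \<omega>) \<partial>lborel)"
      using C by (intro nn_integral_mono) (simp add: ennreal_mult[symmetric] ennreal_leI)
    also have "\<dots> = ennreal C * (\<integral>\<^sup>+\<omega>. ?w (?x \<omega>) \<partial>lborel)"
      using measurable_vstack[OF wm] by (intro nn_integral_cmult) simp
    also have "\<dots> < \<infinity>"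
    proof -
      \<comment> \<open>The smallest exponent occurs at \<open>j = CARD('k) - 1\<close>, and
        \<open>lam - real (CARD('k) - 1)\<close> still exceeds the dimension \<open>CARD('m)\<close>
        by the assumption on \<open>lam\<close>.\<close>
      have "radial_integral TYPE(real^'m) (lam - real j) < top" if "j < CARD('k)" for j
        using radial_integral_finite[where 'a = "real^'m", of "lam - real j"] lam that by simp
      then have "(\<Prod>j<CARD('k). radial_integral TYPE(real^'m) (lam - real j)) < top"
        by (simp add: less_top[symmetric] ennreal_prod_eq_top)
      then show ?thesis
        unfolding nn_integral_gram_vstack[OF o] by (simp add: ennreal_mult_less_top)
    qed
    finally show "(\<integral>\<^sup>+\<omega>. ennreal (norm (f (?x \<omega>))) \<partial>lborel) < \<infinity>" .
  qed
next
  fix lam :: real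
  define s where "s = real CARD('k) + real CARD('m) - 1"
  assume "lam \<le> real CARD('k) + real CARD('m) - 1"
  then have lam: "lam \<le> s"
    by (simp add: s_def)
  \<comment> \<open>The witness has the critical exponent \<open>s\<close> and does not depend on
    \<open>lam\<close>.\<close>
  define f where "f x = det (mat 1 + transpose x ** x) powr (- s / 2)" for x :: "real^'m^('k + 'l)"
  \<comment> \<open>The determinant is at least 1 and \<open>- s / 2 \<le> - lam / 2\<close>, so the
    comparison holds pointwise with constant 1.\<close>
  have "matrix_decay lam f"
    unfolding matrix_decay_def
  proof (rule landau_o.big_mono, rule always_eventually, rule allI)
    show "norm (f x) \<le> norm (of_real (\<bar>det (mat 1 + transpose x ** x)\<bar> powr (- lam / 2)) :: real)" for x
      using one_le_det_mat1_plus_gram[of x] lam by (simp add: f_def powr_mono)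
  qed
  moreover have "radon_transform_nonneg f \<xi> t = \<infinity>" if \<xi>: "\<xi> \<in> stiefel" for \<xi> t
  proof -
    have o: "orthogonal_matrix (frame_rotation \<xi>)"
      using frame_rotation[OF \<xi>] by (simp add: is_frame_rotation_def rotation_matrix_def)
    have "(\<Prod>j<CARD('k). radial_integral TYPE(real^'m) (s - real j)) = top"
    proof (rule prod_ennreal_eq_top)
      \<comment> \<open>The last factor of the product is the one at the critical exponent
        \<open>CARD('m)\<close>; it is infinite, and no other factor vanishes.\<close>
      have "s - real (CARD('k) - 1) = real DIM(real^'m)"
        by (simp add: s_def of_nat_diff Suc_leI)
      then show "radial_integral TYPE(real^'m) (s - real (CARD('k) - 1)) = top"
        using radial_integral_infinite[where 'a = "real^'m"] by simp
    qed (auto simp: radial_integral_pos)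
    \<comment> \<open>The determinant in front of the product is positive, so its power is nonzero
      and the infinite product stays infinite for every \<open>t\<close>.\<close>
    moreover have "0 < det (mat 1 + transpose t ** t)"
      using one_le_det_mat1_plus_gram[of t] by linarith
    ultimately show ?thesis
      unfolding radon_transform_nonneg_def radon_integrand_def[abs_def] f_def nn_integral_gram_vstack[OF o]
      by (simp add: ennreal_mult_top)
  qed
  ultimately show "\<exists>f :: real^'m^('k + 'l) \<Rightarrow> real.
      continuous_on UNIV f \<and> (\<forall>x. 0 \<le> f x) \<and> matrix_decay lam f \<and>
      (\<forall>\<xi>\<in>stiefel. \<forall>t. radon_transform_nonneg f \<xi> t = \<infinity>)"
    by (intro exI[of _ f]) (auto simp: f_def[abs_def] continuous_on_gram_powr)
qed

end
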